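(* Let $G=(V(G),A(G))$ be a weakly connected $d$-regular digraph with $d\geq 2$. For every integer $n\geq 1$: (a) $M(L^n(G))=Z(L^n(G))=(d-1)\,d^{n-1}\,|V(G)|$; (b) $\mathrm{mr}(L^n(G))=d^{n-1}\,|V(G)|$.
   Context: A digraph $G$ has a finite non-empty vertex set $V(G)$ and a set $A(G)\subseteq V(G)\times V(G)$ of arcs; loops $(u,u)$ are allowed. $N^+_G(v)=\{u:(v,u)\in A(G)\}$, $N^-_G(v)=\{w:(w,v)\in A(G)\}$. $G$ is $d$-regular if $|N^+_G(v)|=|N^-_G(v)|=d$ for all $v$. $G$ is weakly connected if its underlying undirected graph is connected. Line digraph: $L(G)$ has vertex set $\{uv:(u,v)\in A(G)\}$, with an arc from $uv$ to $xy$ exactly when $v=x$. $L^0(G)=G$ and $L^r(G)=L(L^{r-1}(G))$ for $r\geq 1$. Zero forcing in a digraph $H$: for non-empty $S\subseteq V(H)$ put $B^0(S)=S$ and, for $i\ge 0$: if $H$ has no loops, $B^{i+1}(S)=B^i(S)\cup\{v\in V(H)\setminus B^i(S):\exists u\in B^i(S),\ N^+_H(u)\setminus B^i(S)=\{v\}\}$; if $H$ has at least one loop, $B^{i+1}(S)=B^i(S)\cup\{v\in V(H)\setminus B^i(S):\exists u\in V(H),\ N^+_H(u)\setminus B^i(S)=\{v\}\}$. $S$ is a zero forcing set if $B^m(S)=V(H)$ for some $m\ge 0$. $Z(H)$ is the minimum cardinality of a zero forcing set of $H$. Maximum nullity and minimum rank: for a digraph $H$ of order $p$ (vertices indexing rows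 and columns), let $\mathcal S(H)$ be the set of real $p\times p$ matrices $X$ such that: if $H$ has no loops, for all $i\neq j$, $X_{i,j}\neq 0\Leftrightarrow (i,j)\in A(H)$ (diagonal entries arbitrary); if $H$ has at least one loop, for all $i,j$, $X_{i,j}\neq 0\Leftrightarrow (i,j)\in A(H)$. $M(H)=\max\{\operatorname{null}X:X\in\mathcal S(H)\}$, where $\operatorname{null}X$ is the dimension of the kernel, and $\mathrm{mr}(H)=\min\{\operatorname{rank}X:X\in\mathcal S(H)\}$. *)

theory Defs
  imports
    "Graph_Theory.Graph_Theory"
    "Jordan_Normal_Form.Matrix_Kernel"
    "Jordan_Normal_Form.DL_Rank"
begin

definition out_nbrs :: "'a pair_pre_digraph \<Rightarrow> 'a \<Rightarrow> 'a set" where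
  "out_nbrs G v = {u. (v, u) \<in> parcs G}"

definition in_nbrs :: "'a pair_pre_digraph \<Rightarrow> 'a \<Rightarrow> 'a set" where
  "in_nbrs G v = {w. (w, v) \<in> parcs G}"

definition regular_digraph :: "nat \<Rightarrow> 'a pair_pre_digraph \<Rightarrow> bool" where
  "regular_digraph d G \<longleftrightarrow>
     (\<forall>v \<in> pverts G. card (out_nbrs G v) = d \<and> card (in_nbrs G v) = d)"

definition has_loop :: "'a pair_pre_digraph \<Rightarrow> bool" where
  "has_loop G \<longleftrightarrow> (\<exists>u. (u, u) \<in> parcs G)"

definition line_digraph :: "'a pair_pre_digraph \<Rightarrow> ('a \<times> 'a) pair_pre_digraph" where
  "line_digraph G =
     \<lparr> pverts = parcs G,
       parcs = {((u, v), (x, y)) | u v x y.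
                  (u, v) \<in> parcs G \<and> (x, y) \<in> parcs G \<and> v = x} \<rparr>"

(* The vertex type of line_digraph differs from that of its argument.  To iterate it an
   arbitrary number of times, vertices are renamed injectively into a single type that
   contains the vertices of G and is closed under forming formal arcs; every iterate
   equals the iterated line digraph up to this renaming. *)
datatype 'a lvertex = Base 'a | Arc "'a lvertex" "'a lvertex"

definition rename_vertices :: "('a \<Rightarrow> 'b) \<Rightarrow> 'a pair_pre_digraph \<Rightarrow> 'b pair_pre_digraph" where
  "rename_vertices f G = \<lparr> pverts = f ` pverts G, parcs = map_prod f f ` parcs G \<rparr>"

primrec iter_line_digraph :: "nat \<Rightarrow> 'a pair_pre_digraph \<Rightarrow> 'a lvertex pair_pre_digraph" where
  "iter_line_digraph 0 G = rename_vertices Base G"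
| "iter_line_digraph (Suc r) G =
     rename_vertices (\<lambda>(u, v). Arc u v) (line_digraph (iter_line_digraph r G))"

primrec forced :: "'a pair_pre_digraph \<Rightarrow> 'a set \<Rightarrow> nat \<Rightarrow> 'a set" where
  "forced H S 0 = S"
| "forced H S (Suc i) = forced H S i \<union>
     {v \<in> pverts H - forced H S i.
        \<exists>u \<in> (if has_loop H then pverts H else forced H S i).
          out_nbrs H u - forced H S i = {v}}"

definition zero_forcing_set :: "'a pair_pre_digraph \<Rightarrow> 'a set \<Rightarrow> bool" where
  "zero_forcing_set H S \<longleftrightarrow>
     S \<noteq> {} \<and> S \<subseteq> pverts H \<and> (\<exists>m. forced H S m = pverts H)"

definition zero_forcing_number :: "'a pair_pre_digraph \<Rightarrow> nat" where
  "zero_forcing_number H = Min {card S | S. zero_forcing_set H S}"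

(* Row and column i of the matrix belong to the vertex vs ! i.  All enumerations vs of the
   vertices are admitted; two enumerations give families that differ by a simultaneous
   permutation of rows and columns, so rank and nullity do not depend on the choice. *)
definition pattern_matrices :: "'a pair_pre_digraph \<Rightarrow> real mat set" where
  "pattern_matrices H =
     {X. \<exists>vs. distinct vs \<and> set vs = pverts H \<and>
          X \<in> carrier_mat (length vs) (length vs) \<and>
          (\<forall>i < length vs. \<forall>j < length vs.
             has_loop H \<or> i \<noteq> j \<longrightarrow>
             (X $$ (i, j) \<noteq> 0 \<longleftrightarrow> (vs ! i, vs ! j) \<in> parcs H))}"

definition max_nullity :: "'a pair_pre_digraph \<Rightarrow> nat" where
  "max_nullity H = Max {kernel_dim X | X. X \<in> pattern_matrices H}"

definition min_rank :: "'a pair_pre_digraph \<Rightarrow> nat" where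
  "min_rank H = Min {vec_space.rank (dim_row X) X | X. X \<in> pattern_matrices H}"

end

theory Submission
  imports Defs
begin

text \<open>
  Let \<open>K = L\<^sup>n\<^sup>-\<^sup>1(G)\<close> and let \<open>N = d\<^sup>n\<^sup>-\<^sup>1 |V(G)|\<close> be its order. Then \<open>K\<close> is again \<open>d\<close>-regular, and
  \<open>H = L(K)\<close> has \<open>d N\<close> vertices, namely the arcs of \<open>K\<close>. Two facts bracket the nullity of \<open>H\<close>.

  From below: the out-neighbours of an arc depend only on the vertex where it ends, and its
  in-neighbours only on the vertex where it starts. Hence two columns of the adjacency matrix of
  \<open>H\<close> agree as soon as the two arcs start at the same vertex of \<open>K\<close>. There are at most \<open>N\<close>
  different columns, so the rank is at most \<open>N\<close> and, by rank-nullity, the nullity at least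
  \<open>d N - N = (d - 1) N\<close>.

  From above: if \<open>X v = 0\<close> for a matrix \<open>X\<close> with the pattern of \<open>H\<close> and \<open>v\<close> vanishes on a set
  \<open>S\<close>, then each forcing step reads off from one row of \<open>X v = 0\<close> that one more coordinate of
  \<open>v\<close> is zero. So \<open>v\<close> is determined by its coordinates in a zero forcing set, and every nullity is at
  most the size of every zero forcing set (\<open>kernel_dim_le_zero_forcing\<close>). It remains to find a
  zero forcing set with \<open>(d - 1) N\<close> elements: leave out one out-arc \<open>f v\<close> at each vertex \<open>v\<close> of
  \<open>K\<close>, in any way whatever. Any coloured arc ending in \<open>v\<close> forces \<open>f v\<close>, since all other arcs
  out of \<open>v\<close> are coloured. If \<open>U\<close> is the set of vertices \<open>v\<close> for which \<open>f v\<close> never gets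
  coloured, then no arc into \<open>U\<close> gets coloured; so the \<open>d |U|\<close> arcs into \<open>U\<close> are among the
  \<open>|U|\<close> arcs \<open>f u\<close> with \<open>u \<in> U\<close>, and \<open>d \<ge> 2\<close> leaves only \<open>U = {}\<close>
  (\<open>transversal_complement_zero_forcing\<close>).

  Therefore maximum nullity and zero forcing number both equal \<open>(d - 1) N\<close>, and rank-nullity
  turns this into minimum rank \<open>N\<close>.
\<close>

section \<open>Rank and nullity of matrices\<close>

text \<open>
  The rank-nullity theorem for linear maps, applied to \<open>v \<mapsto> X v\<close>, whose image is the column space.
\<close>

lemma rank_plus_kernel_dim:
  fixes X :: "'a::field mat"
  assumes X: "X \<in> carrier_mat nr nc"
  shows "vec_space.rank nr X + kernel_dim X = nc"
proof -
  interpret kernel nr nc X by unfold_locales (rule X)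
  interpret W: vec_space "TYPE('a)" nr .
  interpret T: linear_map class_ring "module_vec TYPE('a) nc" "module_vec TYPE('a) nr" "(*\<^sub>v) X"
    by (intro linear_map.intro mod_hom.intro VS_Connect.vec_vs NC.module_axioms W.module_axioms
        mod_hom_axioms.intro)
      (use X in \<open>auto simp: LinearCombinations.module_hom_def module_vec_def mult_add_distrib_mat_vec mult_mat_vec\<close>)
  have "T.kerT = mat_kernel X"
    unfolding T.ker_def mat_kernel[OF X] by (simp add: module_vec_def)
  moreover have "T.imT = W.span (set (cols X))"
  proof -
    have "T.imT = (*\<^sub>v) X ` carrier_vec nc"
      by (simp add: T.im_def)
    also have "\<dots> = W.col_space X"
      unfolding W.col_space_eq[OF X] using X by auto
    finally show ?thesis by (simp add: W.col_space_def)
  qed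
  moreover note T.rank_nullity[OF NC.fin_dim]
  ultimately show ?thesis
    unfolding W.rank_def kernel_dim by (simp add: NC.dim_is_n)
qed

text \<open>
  Reading off the coordinates in \<open>J\<close> is an injective linear map from the kernel into a space of
  dimension \<open>|J|\<close>.
\<close>

lemma kernel_dim_le_card_determining_coords:
  fixes X :: "'a::field mat"
  assumes X: "X \<in> carrier_mat nr nc" and J: "J \<subseteq> {..<nc}"
    and det: "\<And>v. v \<in> mat_kernel X \<Longrightarrow> (\<And>j. j \<in> J \<Longrightarrow> v $ j = 0) \<Longrightarrow> v = 0\<^sub>v nc"
  shows "kernel_dim X \<le> card J"
proof -
  interpret kernel nr nc X by unfold_locales (rule X)
  interpret W: vec_space "TYPE('a)" "card J" .
  have fin: "finite J" using J finite_subset by blast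
  define e where "e = (!) (sorted_list_of_set J)"
  have e: "e ` {..<card J} = J"
    unfolding e_def using fin
    by (metis length_sorted_list_of_set list.set_map map_nth set_sorted_list_of_set set_upt
        atLeast_upt)
  have e_lt: "e i < nc" if "i < card J" for i
    using e J that by blast
  define \<pi> where "\<pi> = (\<lambda>v :: 'a vec. vec (card J) (\<lambda>i. v $ e i))"
  have kc: "mat_kernel X \<subseteq> carrier_vec nc" by (rule mat_kernel_carrier[OF X])
  have hom: "\<pi> \<in> module_hom class_ring VK (module_vec TYPE('a) (card J))"
  proof -
    have "dim_vec v = nc" if "v \<in> mat_kernel X" for v
      using that kc by auto
    then show ?thesis
      unfolding LinearCombinations.module_hom_def \<pi>_def
      by (auto simp: module_vec_def vec_eq_iff e_lt)
  qed
  interpret T: linear_map class_ring VK "module_vec TYPE('a) (card J)" \<pi>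
    by (intro linear_map.intro mod_hom.intro Ker.vectorspace_axioms VS_Connect.vec_vs
        Ker.module_axioms W.module_axioms mod_hom_axioms.intro hom)
  have fd: "Ker.fin_dim"
    using kernel_basis_exists[OF X] unfolding Ker.basis_def Ker.fin_dim_def by auto
  have "inj_on \<pi> (carrier VK)"
  proof (rule T.Ke0_imp_inj)
    have "v = 0\<^sub>v nc" if v: "v \<in> mat_kernel X" and 0: "\<pi> v = 0\<^sub>v (card J)" for v
    proof (rule det[OF v])
      fix j assume "j \<in> J"
      then obtain i where i: "i < card J" "j = e i" using e by blast
      have "\<pi> v $ i = 0" using 0 i by simp
      then show "v $ j = 0" using i by (simp add: \<pi>_def)
    qed
    moreover have "0\<^sub>v nc \<in> mat_kernel X" "\<pi> (0\<^sub>v nc) = 0\<^sub>v (card J)"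
      using X by (auto simp: mat_kernel \<pi>_def e_lt vec_eq_iff)
    ultimately show "carrier (VK\<lparr>carrier := T.kerT\<rparr>) = {\<zero>\<^bsub>VK\<^esub>}"
      unfolding T.ker_def by (auto simp: module_vec_def)
  qed
  note inj = this
  \<comment> \<open>Corestricting to the image makes the map bijective, which identifies the two dimensions and
    shows that the image is finite-dimensional.\<close>
  interpret T': linear_map class_ring VK "W.V\<lparr>carrier := T.imT\<rparr>" \<pi>
    by (intro linear_map.intro mod_hom.intro Ker.vectorspace_axioms Ker.module_axioms
        W.subspace_is_vs T.imT_is_subspace W.submodule_is_module T.im_is_submodule
        mod_hom_axioms.intro)
      (use hom in \<open>auto simp: LinearCombinations.module_hom_def T.im_def\<close>)
  have surj: "\<pi> ` carrier VK = carrier (W.V\<lparr>carrier := T.imT\<rparr>)"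
    by (simp add: T.im_def)
  have "kernel_dim X = vectorspace.dim class_ring (W.V\<lparr>carrier := T.imT\<rparr>)"
    using T'.dim_eq[OF fd inj surj] by simp
  also have "\<dots> \<le> W.dim"
    by (rule W.subspace_dim[OF T.imT_is_subspace W.fin_dim T'.surj_fin_dim[OF fd surj]])
  finally show ?thesis by (simp add: W.dim_is_n)
qed

lemma rank_le_card_set_cols:
  fixes X :: "'a::field mat"
  assumes X: "X \<in> carrier_mat nr nc"
  shows "vec_space.rank nr X \<le> card (set (cols X))"
proof -
  interpret W: vec_space "TYPE('a)" nr .
  have "W.lin_indpt {}"
    using W.fin_dim W.finite_basis_exists W.subset_li_is_li unfolding W.basis_def by blast
  then obtain S where S: "maximal S (\<lambda>T. T \<subseteq> set (cols X) \<and> W.lin_indpt T)"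
    using maximal_exists_superset[of "set (cols X)" "\<lambda>T. T \<subseteq> set (cols X) \<and> W.lin_indpt T" "{}"]
    by auto
  then show ?thesis
    unfolding W.rank_card_indpt[OF X S] by (auto simp: maximal_def intro: card_mono)
qed

section \<open>Zero forcing bounds the nullity\<close>

lemma forced_subset_pverts: "S \<subseteq> pverts H \<Longrightarrow> forced H S m \<subseteq> pverts H"
  by (induction m) auto

lemma forced_mono: "m \<le> k \<Longrightarrow> forced H S m \<subseteq> forced H S k"
  by (rule lift_Suc_mono_le) auto

text \<open>
  The forcing process increases inside a finite set. A stage of maximal cardinality is therefore a
  fixpoint.
\<close>

lemma forced_stabilises:
  assumes fin: "finite (pverts H)" and S: "S \<subseteq> pverts H"
  obtains m where "forced H S (Suc m) = forced H S m"
proof -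
  have fin_f: "finite (forced H S m)" for m
    using forced_subset_pverts[OF S] fin finite_subset by blast
  have "\<forall>m. True \<longrightarrow> card (forced H S m) < Suc (card (pverts H))"
    using card_mono[OF fin forced_subset_pverts[OF S]] by (simp add: less_Suc_eq_le)
  from ex_has_greatest_nat[OF TrueI this]
  obtain m where "\<And>k. card (forced H S k) \<le> card (forced H S m)"
    by auto
  then have "forced H S m = forced H S (Suc m)"
    by (intro card_seteq fin_f forced_mono le_SucI order_refl)
  then show thesis by (intro that[OF sym])
qed

text \<open>
  If \<open>u\<close> forces \<open>w\<close>, then row \<open>u\<close> of \<open>X v = 0\<close> has a single term that is not yet known to vanish,
  namely \<open>X\<^sub>u\<^sub>w v\<^sub>w\<close>. For a digraph without loops the free diagonal entry in row \<open>u\<close> does no harm,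
  because the forcing rule then asks \<open>u\<close> to be coloured, which makes \<open>v\<^sub>u\<close> zero.
\<close>

lemma kernel_vanishes_on_forced:
  fixes X :: "'a::idom mat"
  assumes dist: "distinct vs" and vs: "set vs = pverts H"
    and X: "X \<in> carrier_mat (length vs) (length vs)"
    and pat: "\<And>i j. \<lbrakk>i < length vs; j < length vs; has_loop H \<or> i \<noteq> j\<rbrakk>
                \<Longrightarrow> X $$ (i, j) \<noteq> 0 \<longleftrightarrow> (vs ! i, vs ! j) \<in> parcs H"
    and S: "S \<subseteq> pverts H"
    and v: "v \<in> mat_kernel X"
    and v0: "\<And>j. \<lbrakk>j < length vs; vs ! j \<in> S\<rbrakk> \<Longrightarrow> v $ j = 0"
  shows "\<lbrakk>j < length vs; vs ! j \<in> forced H S m\<rbrakk> \<Longrightarrow> v $ j = 0"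
proof (induction m arbitrary: j)
  case 0
  then show ?case using v0 by simp
next
  case (Suc m)
  let ?n = "length vs" and ?F = "forced H S m"
  show ?case
  proof (cases "vs ! j \<in> ?F")
    case True
    then show ?thesis using Suc by simp
  next
    case False
    then obtain u where u: "u \<in> (if has_loop H then pverts H else ?F)"
      and nb: "out_nbrs H u - ?F = {vs ! j}"
      using Suc.prems by auto
    have "u \<in> pverts H"
      using u forced_subset_pverts[OF S] by (auto split: if_splits)
    then obtain i where i: "i < ?n" "vs ! i = u"
      using vs by (metis in_set_conv_nth)
    have uj: "(u, vs ! j) \<in> parcs H"
      using nb by (auto simp: out_nbrs_def)
    then have "has_loop H \<or> i \<noteq> j"
      using i by (auto simp: has_loop_def)
    then have Xij: "X $$ (i, j) \<noteq> 0"
      using pat i Suc.prems uj by auto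
    have other: "X $$ (i, k) * v $ k = 0" if k: "k < ?n" "k \<noteq> j" for k
    proof (cases "vs ! k \<in> ?F")
      case True
      then show ?thesis using Suc.IH k by simp
    next
      case notF: False
      then have "has_loop H \<or> i \<noteq> k"
        using u i by (auto split: if_splits)
      moreover have "(u, vs ! k) \<notin> parcs H"
      proof
        assume "(u, vs ! k) \<in> parcs H"
        then have "vs ! k = vs ! j"
          using nb notF by (auto simp: out_nbrs_def)
        then show False
          using dist k Suc.prems by (simp add: nth_eq_iff_index_eq)
      qed
      ultimately show ?thesis
        using pat[of i k] i k by simp
    qed
    have "0 = (X *\<^sub>v v) $ i"
      using i by (simp add: mat_kernelD(2)[OF X v])
    also have "\<dots> = (\<Sum>k\<in>{0..<?n}. X $$ (i, k) * v $ k)"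
      using i X mat_kernelD(1)[OF X v] by (simp add: scalar_prod_def)
    also have "\<dots> = (\<Sum>k\<in>{j}. X $$ (i, k) * v $ k)"
      using Suc.prems other by (intro sum.mono_neutral_right) auto
    finally show ?thesis using Xij by simp
  qed
qed

text \<open>
  Once every vertex is forced, a kernel vector that vanishes on \<open>S\<close> vanishes everywhere.
\<close>

lemma kernel_dim_le_zero_forcing:
  assumes X: "X \<in> pattern_matrices H" and S: "zero_forcing_set H S"
  shows "kernel_dim X \<le> card S"
proof -
  obtain vs where dist: "distinct vs" and vs: "set vs = pverts H"
    and carr: "X \<in> carrier_mat (length vs) (length vs)"
    and pat: "\<And>i j. \<lbrakk>i < length vs; j < length vs; has_loop H \<or> i \<noteq> j\<rbrakk>
                \<Longrightarrow> X $$ (i, j) \<noteq> 0 \<longleftrightarrow> (vs ! i, vs ! j) \<in> parcs H"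
    using X unfolding pattern_matrices_def by blast
  obtain m where sub: "S \<subseteq> pverts H" and m: "forced H S m = pverts H"
    using S unfolding zero_forcing_set_def by blast
  define J where "J = {j. j < length vs \<and> vs ! j \<in> S}"
  have "kernel_dim X \<le> card J"
  proof (rule kernel_dim_le_card_determining_coords[OF carr])
    fix v assume v: "v \<in> mat_kernel X" and 0: "\<And>j. j \<in> J \<Longrightarrow> v $ j = 0"
    have "v $ j = 0" if j: "j < length vs" for j
    proof (rule kernel_vanishes_on_forced[OF dist vs carr pat sub v _ j])
      show "vs ! j \<in> forced H S m" using j vs m by auto
    qed (use 0 in \<open>auto simp: J_def\<close>)
    then show "v = 0\<^sub>v (length vs)"
      using mat_kernelD(1)[OF carr v] by auto
  qed (auto simp: J_def)
  also have "card J \<le> card S"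
  proof (rule card_inj_on_le)
    show "inj_on ((!) vs) J" using dist by (auto simp: J_def inj_on_def nth_eq_iff_index_eq)
    show "finite S" using sub vs by (metis finite_set finite_subset)
  qed (auto simp: J_def)
  finally show ?thesis .
qed

section \<open>Line digraphs of regular digraphs\<close>

text \<open>
  Positivity of \<open>d\<close> makes the fibres finite, since infinite sets have cardinality \<open>0\<close>.
\<close>

lemma card_fibres:
  assumes "finite U" and "\<And>u. u \<in> U \<Longrightarrow> card {a \<in> A. f a = u} = d" and "d > 0"
  shows "card {a \<in> A. f a \<in> U} = d * card U"
proof -
  have "{a \<in> A. f a \<in> U} = (\<Union>u\<in>U. {a \<in> A. f a = u})" by auto
  also have "card \<dots> = (\<Sum>u\<in>U. card {a \<in> A. f a = u})"
    using assms by (intro card_UN_disjoint) (auto intro!: card_ge_0_finite)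
  finally show ?thesis using assms by simp
qed

text \<open>
  The line digraph of a \<open>d\<close>-regular multidigraph on \<open>V\<close>, described by the incidence maps that send
  an arc to its two end points. Any injective renaming of the arcs gives another instance, so the
  names used for the iterates do not enter the argument.
\<close>

locale regular_arc_incidence =
  fixes H :: "'b pair_pre_digraph" and V :: "'v set" and src tgt :: "'b \<Rightarrow> 'v" and d :: nat
  assumes finite_V: "finite V" and V_nonempty: "V \<noteq> {}"
    and src_in_V: "a \<in> pverts H \<Longrightarrow> src a \<in> V"
    and tgt_in_V: "a \<in> pverts H \<Longrightarrow> tgt a \<in> V"
    and parcs_iff: "(a, b) \<in> parcs H \<longleftrightarrow> a \<in> pverts H \<and> b \<in> pverts H \<and> tgt a = src b"
    and card_src: "v \<in> V \<Longrightarrow> card {a \<in> pverts H. src a = v} = d"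
    and card_tgt: "v \<in> V \<Longrightarrow> card {a \<in> pverts H. tgt a = v} = d"
    and d_ge_2: "d \<ge> 2"
begin

lemma card_pverts: "card (pverts H) = d * card V"
proof -
  have "{a \<in> pverts H. src a \<in> V} = pverts H" using src_in_V by blast
  then show ?thesis using card_fibres[OF finite_V card_src] d_ge_2 by simp
qed

lemma finite_pverts: "finite (pverts H)"
  using card_pverts finite_V V_nonempty d_ge_2 by (intro card_ge_0_finite) (simp add: card_gt_0_iff)

lemma out_nbrs_eq: "a \<in> pverts H \<Longrightarrow> out_nbrs H a = {b \<in> pverts H. src b = tgt a}"
  and in_nbrs_eq: "a \<in> pverts H \<Longrightarrow> in_nbrs H a = {b \<in> pverts H. tgt b = src a}"
  by (auto simp: out_nbrs_def in_nbrs_def parcs_iff)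

lemma regular: "regular_digraph d H"
  unfolding regular_digraph_def
  by (auto simp: out_nbrs_eq in_nbrs_eq src_in_V tgt_in_V card_src card_tgt)

text \<open>
  At a fixpoint of the forcing process, counting the arcs into the set \<open>U\<close> of vertices whose selected arc stays uncoloured gives
  \<open>d |U| \<le> |U|\<close>. The forcing arc used is always coloured, so the argument covers
  the rules for digraphs with and without loops alike.
\<close>

lemma transversal_complement_zero_forcing:
  assumes f: "\<And>v. v \<in> V \<Longrightarrow> f v \<in> pverts H \<and> src (f v) = v"
  shows "zero_forcing_set H (pverts H - f ` V)"
    and "card (pverts H - f ` V) = (d - 1) * card V"
proof -
  let ?S = "pverts H - f ` V"
  have "inj_on f V" using f by (intro inj_on_inverseI[of _ src]) simp
  then show card_S: "card ?S = (d - 1) * card V"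
    using f finite_V by (subst card_Diff_subset)
      (auto simp: card_pverts card_image diff_mult_distrib)
  obtain m where m: "forced H ?S (Suc m) = forced H ?S m"
    by (rule forced_stabilises[OF finite_pverts Diff_subset])
  define B where "B = forced H ?S m"
  have S_B: "?S \<subseteq> B" unfolding B_def using forced_mono[of 0 m H ?S] by simp
  have B_sub: "B \<subseteq> pverts H" unfolding B_def by (rule forced_subset_pverts) auto
  define U where "U = {v \<in> V. f v \<notin> B}"
  have "finite U" "U \<subseteq> V" using finite_V by (auto simp: U_def)
  \<comment> \<open>A coloured arc into a vertex of \<open>U\<close> would force the selected arc there.\<close>
  have stuck: "a \<notin> B" if a: "a \<in> pverts H" and tgt: "tgt a \<in> U" for a
  proof
    assume aB: "a \<in> B"
    let ?v = "tgt a"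
    have v: "?v \<in> V" "f ?v \<notin> B" using tgt by (auto simp: U_def)
    have "out_nbrs H a - B = {f ?v}"
    proof (intro equalityI subsetI)
      fix b assume b: "b \<in> out_nbrs H a - B"
      then have "b \<in> f ` V" "src b = ?v" using S_B by (auto simp: out_nbrs_eq[OF a])
      then show "b \<in> {f ?v}" using f by auto
    qed (use v f in \<open>auto simp: out_nbrs_eq[OF a]\<close>)
    then have "\<exists>u \<in> (if has_loop H then pverts H else B). out_nbrs H u - B = {f ?v}"
      using a aB by (intro bexI[of _ a]) auto
    then have "f ?v \<in> forced H ?S (Suc m)"
      unfolding forced.simps B_def[symmetric] using v f by blast
    then show False using v unfolding m B_def by blast
  qed
  have "{a \<in> pverts H. tgt a \<in> U} \<subseteq> f ` U"
  proof safe
    fix a assume a: "a \<in> pverts H" "tgt a \<in> U"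
    then have "a \<notin> B" by (rule stuck)
    then obtain u where "u \<in> V" "a = f u" using a S_B by blast
    then show "a \<in> f ` U" using \<open>a \<notin> B\<close> by (auto simp: U_def)
  qed
  then have "card {a \<in> pverts H. tgt a \<in> U} \<le> card U"
    using \<open>finite U\<close> by (meson card_image_le card_mono finite_imageI order_trans)
  moreover have "card {a \<in> pverts H. tgt a \<in> U} = d * card U"
    using \<open>finite U\<close> \<open>U \<subseteq> V\<close> card_tgt d_ge_2 by (intro card_fibres) auto
  ultimately have "d * card U \<le> card U" by simp
  moreover have "2 * card U \<le> d * card U" using d_ge_2 by (rule mult_le_mono1)
  ultimately have "card U = 0" by linarith
  then have "U = {}" using \<open>finite U\<close> by simp
  then have "B = pverts H" using S_B B_sub by (auto simp: U_def)
  moreover have "card ?S > 0"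
    unfolding card_S using d_ge_2 finite_V V_nonempty by (simp add: card_gt_0_iff)
  then have "?S \<noteq> {}" by (metis card.empty less_irrefl)
  ultimately show "zero_forcing_set H ?S"
    unfolding zero_forcing_set_def B_def by blast
qed

text \<open>
  Arcs with the same starting vertex have the same in-neighbours, hence equal columns in the
  adjacency matrix, which leaves at most \<open>|V|\<close> different columns.
\<close>

lemma adjacency_matrix_low_rank:
  obtains X where "X \<in> pattern_matrices H" "vec_space.rank (dim_row X) X \<le> card V"
proof -
  obtain vs where vs: "distinct vs" "set vs = pverts H"
    using finite_distinct_list[OF finite_pverts] by blast
  let ?n = "length vs"
  define X :: "real mat"
    where "X = mat ?n ?n (\<lambda>(i, j). if (vs ! i, vs ! j) \<in> parcs H then 1 else 0)"
  have X: "X \<in> carrier_mat ?n ?n" by (simp add: X_def)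
  have "X \<in> pattern_matrices H"
    unfolding pattern_matrices_def using vs X by (auto simp: X_def intro!: exI[of _ vs] split: if_splits)
  moreover have "vec_space.rank (dim_row X) X \<le> card V"
  proof -
    \<comment> \<open>The column of an arc starting at \<open>v\<close> is the indicator vector \<open>g v\<close> of the arcs ending at \<open>v\<close>.\<close>
    define g :: "'v \<Rightarrow> real vec" where "g v = vec ?n (\<lambda>i. if tgt (vs ! i) = v then 1 else 0)" for v
    have in_vs: "vs ! i \<in> pverts H" if "i < ?n" for i
      using nth_mem[OF that] unfolding vs(2) .
    have "set (cols X) \<subseteq> g ` V"
    proof
      fix c assume "c \<in> set (cols X)"
      then obtain j where j: "j < ?n" "c = col X j"
        using X by (auto simp: cols_def)
      have "c = g (src (vs ! j))"
        unfolding j g_def using j X in_vs by (auto simp: X_def parcs_iff)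
      then show "c \<in> g ` V" using src_in_V in_vs j by blast
    qed
    then have "card (set (cols X)) \<le> card V"
      using finite_V by (meson card_image_le card_mono finite_imageI order_trans)
    then show ?thesis
      using rank_le_card_set_cols[OF X] X by simp
  qed
  ultimately show thesis using that by blast
qed

theorem nullity_zero_forcing_rank:
  shows "max_nullity H = (d - 1) * card V"
    and "zero_forcing_number H = (d - 1) * card V"
    and "min_rank H = card V"
proof -
  let ?Z = "(d - 1) * card V"
  have split: "card (pverts H) = ?Z + card V"
    using d_ge_2 by (cases d) (auto simp: card_pverts)
  have "\<forall>v \<in> V. \<exists>a. a \<in> pverts H \<and> src a = v"
  proof
    fix v assume "v \<in> V"
    then have "card {a \<in> pverts H. src a = v} \<noteq> 0" using card_src d_ge_2 by simp
    then show "\<exists>a. a \<in> pverts H \<and> src a = v" by (auto simp: card_eq_0_iff)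
  qed
  then obtain f where f: "\<And>v. v \<in> V \<Longrightarrow> f v \<in> pverts H \<and> src (f v) = v" by metis
  note S = transversal_complement_zero_forcing[OF f]
  obtain A where A: "A \<in> pattern_matrices H" and rank_A: "vec_space.rank (dim_row A) A \<le> card V"
    by (rule adjacency_matrix_low_rank)
  have rk: "vec_space.rank (dim_row X) X + kernel_dim X = ?Z + card V"
    if X: "X \<in> pattern_matrices H" for X
  proof -
    obtain vs where "distinct vs" "set vs = pverts H"
      and carr: "X \<in> carrier_mat (length vs) (length vs)"
      using X unfolding pattern_matrices_def by blast
    then have "length vs = ?Z + card V"
      using distinct_card[of vs] split by simp
    then show ?thesis using rank_plus_kernel_dim[OF carr] carr by simp
  qed
  have upper: "kernel_dim X \<le> ?Z" if "X \<in> pattern_matrices H" for X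
    using kernel_dim_le_zero_forcing[OF that S(1)] S(2) by simp
  \<comment> \<open>The adjacency matrix attains the bound: low rank forces its nullity up to \<open>(d - 1) |V|\<close>.\<close>
  have null_A: "kernel_dim A = ?Z"
    using upper[OF A] rk[OF A] rank_A by linarith
  show "max_nullity H = ?Z"
    unfolding max_nullity_def
  proof (rule Max_eqI)
    show "finite {kernel_dim X |X. X \<in> pattern_matrices H}"
      by (rule finite_subset[of _ "{..?Z}"]) (auto dest: upper)
    show "?Z \<in> {kernel_dim X |X. X \<in> pattern_matrices H}"
      using A null_A[symmetric] by blast
  qed (use upper in auto)
  show "min_rank H = card V"
    unfolding min_rank_def
  proof (rule Min_eqI)
    show "finite {vec_space.rank (dim_row X) X |X. X \<in> pattern_matrices H}"
      by (rule finite_subset[of _ "{..?Z + card V}"]) (auto dest: rk)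
    show "card V \<le> r" if "r \<in> {vec_space.rank (dim_row X) X |X. X \<in> pattern_matrices H}" for r
      using that upper rk by fastforce
    show "card V \<in> {vec_space.rank (dim_row X) X |X. X \<in> pattern_matrices H}"
      using A null_A rk[OF A] by (auto intro!: exI[of _ A])
  qed
  show "zero_forcing_number H = ?Z"
    unfolding zero_forcing_number_def
  proof (rule Min_eqI)
    have "{card S |S. zero_forcing_set H S} \<subseteq> card ` Pow (pverts H)"
      by (auto simp: zero_forcing_set_def)
    then show "finite {card S |S. zero_forcing_set H S}"
      using finite_pverts finite_subset by blast
    show "?Z \<le> c" if "c \<in> {card S |S. zero_forcing_set H S}" for c
      using that kernel_dim_le_zero_forcing[OF A] null_A by auto
    show "?Z \<in> {card S |S. zero_forcing_set H S}"
      using S f by (metis (mono_tags, lifting) mem_Collect_eq)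
  qed
qed

end

section \<open>Iterated line digraphs\<close>

text \<open>
  The values on \<open>Base\<close> are arbitrary: these maps are applied only to vertices of a line digraph,
  which are formal arcs.
\<close>

primrec arc_src :: "'a lvertex \<Rightarrow> 'a lvertex" where
  "arc_src (Base x) = Base x"
| "arc_src (Arc u v) = u"

primrec arc_tgt :: "'a lvertex \<Rightarrow> 'a lvertex" where
  "arc_tgt (Base x) = Base x"
| "arc_tgt (Arc u v) = v"

lemma regular_arc_incidence_iter:
  assumes wf: "pair_fin_digraph (iter_line_digraph r G)"
    and reg: "regular_digraph d (iter_line_digraph r G)"
    and ne: "pverts (iter_line_digraph r G) \<noteq> {}" and d: "d \<ge> 2"
  shows "regular_arc_incidence (iter_line_digraph (Suc r) G)
           (pverts (iter_line_digraph r G)) arc_src arc_tgt d"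
proof -
  let ?K = "iter_line_digraph r G" and ?H = "iter_line_digraph (Suc r) G"
  interpret K: pair_fin_digraph ?K by (rule wf)
  have pverts_H: "pverts ?H = {Arc u v | u v. (u, v) \<in> parcs ?K}"
    by (auto simp: rename_vertices_def line_digraph_def image_iff)
  have parcs_H: "(a, b) \<in> parcs ?H \<longleftrightarrow>
      (\<exists>u v w. a = Arc u v \<and> b = Arc v w \<and> (u, v) \<in> parcs ?K \<and> (v, w) \<in> parcs ?K)" for a b
    by (force simp: rename_vertices_def line_digraph_def image_iff)
  show ?thesis
  proof
    show "finite (pverts ?K)" by (rule K.pair_finite_verts)
    show "(a, b) \<in> parcs ?H \<longleftrightarrow> a \<in> pverts ?H \<and> b \<in> pverts ?H \<and> arc_tgt a = arc_src b" for a b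
      unfolding parcs_H pverts_H by auto
    fix v assume v: "v \<in> pverts ?K"
    have "{a \<in> pverts ?H. arc_src a = v} = Arc v ` out_nbrs ?K v"
      unfolding pverts_H by (auto simp: out_nbrs_def)
    then show "card {a \<in> pverts ?H. arc_src a = v} = d"
      using reg v by (simp add: card_image inj_on_def regular_digraph_def)
    have "{a \<in> pverts ?H. arc_tgt a = v} = (\<lambda>u. Arc u v) ` in_nbrs ?K v"
      unfolding pverts_H by (auto simp: in_nbrs_def)
    then show "card {a \<in> pverts ?H. arc_tgt a = v} = d"
      using reg v by (simp add: card_image inj_on_def regular_digraph_def)
  qed (use ne d in \<open>auto simp: pverts_H dest: K.in_arcsD1 K.in_arcsD2 simp del: iter_line_digraph.simps\<close>)
qed

text \<open>
  Regularity passes to the line digraph and the order grows by the factor \<open>d\<close>, so the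
  hypotheses needed for one more line digraph are available at every stage.
\<close>

lemma iter_line_digraph_regular:
  assumes G: "pair_fin_digraph G" "pverts G \<noteq> {}" "regular_digraph d G" and d: "d \<ge> 2"
  shows "pair_fin_digraph (iter_line_digraph r G) \<and> regular_digraph d (iter_line_digraph r G)
       \<and> card (pverts (iter_line_digraph r G)) = d ^ r * card (pverts G)
       \<and> pverts (iter_line_digraph r G) \<noteq> {}"
proof (induction r)
  case 0
  let ?H = "iter_line_digraph 0 G"
  interpret pair_fin_digraph G by (rule G(1))
  have "pair_fin_digraph ?H"
    by standard (auto simp: rename_vertices_def pair_finite_verts pair_finite_arcs
        dest: in_arcsD1 in_arcsD2)
  moreover have "out_nbrs ?H (Base v) = Base ` out_nbrs G v" "in_nbrs ?H (Base v) = Base ` in_nbrs G v" for v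
    by (auto simp: out_nbrs_def in_nbrs_def rename_vertices_def image_iff intro: rev_bexI)
  then have "regular_digraph d ?H"
    using G(3) by (auto simp: regular_digraph_def card_image inj_on_def rename_vertices_def)
  ultimately show ?case
    using G(2) by (auto simp: rename_vertices_def card_image inj_on_def)
next
  case (Suc r)
  interpret regular_arc_incidence "iter_line_digraph (Suc r) G" "pverts (iter_line_digraph r G)"
    arc_src arc_tgt d
    using Suc d by (intro regular_arc_incidence_iter) auto
  have "parcs (iter_line_digraph (Suc r) G)
      \<subseteq> pverts (iter_line_digraph (Suc r) G) \<times> pverts (iter_line_digraph (Suc r) G)"
    using parcs_iff by auto
  moreover from this have "finite (parcs (iter_line_digraph (Suc r) G))"
    using finite_pverts finite_subset by blast
  ultimately have "pair_fin_digraph (iter_line_digraph (Suc r) G)"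
    using finite_pverts by unfold_locales (auto simp del: iter_line_digraph.simps)
  moreover have "card (pverts (iter_line_digraph (Suc r) G)) = d ^ Suc r * card (pverts G)"
    using card_pverts Suc by (simp del: iter_line_digraph.simps)
  moreover from this have "pverts (iter_line_digraph (Suc r) G) \<noteq> {}"
    using d G(2) pair_fin_digraph.pair_finite_verts[OF G(1)] by (auto simp del: iter_line_digraph.simps)
  ultimately show ?case using regular by blast
qed

theorem theorem3p17:
  fixes G :: "'a pair_pre_digraph" and d n :: nat
  assumes "pair_fin_digraph G"
    and "pverts G \<noteq> {}"
    and "connected (with_proj G)"
    and "regular_digraph d G"
    and "d \<ge> 2"
    and "n \<ge> 1"
  shows "max_nullity (iter_line_digraph n G) = zero_forcing_number (iter_line_digraph n G)
       \<and> zero_forcing_number (iter_line_digraph n G) = (d - 1) * d ^ (n - 1) * card (pverts G)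
       \<and> min_rank (iter_line_digraph n G) = d ^ (n - 1) * card (pverts G)"
proof -
  obtain r where n: "n = Suc r" using assms(6) by (cases n) auto
  note K = iter_line_digraph_regular[OF assms(1,2,4,5), of r]
  interpret regular_arc_incidence "iter_line_digraph n G" "pverts (iter_line_digraph r G)"
    arc_src arc_tgt d
    unfolding n using K assms(5) by (intro regular_arc_incidence_iter) auto
  show ?thesis
    using nullity_zero_forcing_rank K by (simp add: n mult.assoc del: iter_line_digraph.simps)
qed

end
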